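(* Let $\mathcal{H}$ be a real Hilbert space and let $T:\mathcal{H}\to\mathcal{H}$. Then, for every $\beta\in(0,1)$, the following two conditions are equivalent. (C1) $T=\mathrm{s\text{-}Prox}_{\varphi}$ for some $\varphi:\mathcal{H}\to(-\infty,+\infty]$ such that $\varphi+\frac{1-\beta}{2}\|\cdot\|^2\in\Gamma_0(\mathcal{H})$. (C2) The following hold jointly: 1) $T=\nabla\psi$ for some Fréchet differentiable convex function $\psi\in\Gamma_0(\mathcal{H})$; 2) $T$ is $\beta$-cocoercive, or equivalently $\beta^{-1}$-Lipschitz continuous. In particular, the following statements hold. (a) Assume that (C1) is satisfied with $\varphi$, and define $\check{\varphi}:=\varphi+\frac{1-\beta}{2}\|\cdot\|^2\in\Gamma_0(\mathcal{H})$. Then $$T=\mathrm{s\text{-}Prox}_{\varphi}=\nabla\Big(\varphi+\tfrac12\|\cdot\|^2\Big)^{*}=\nabla\,{}^{\beta}(\check{\varphi}^{*}),$$ so that $T=\nabla\psi$ with $\psi=(\varphi+\frac12\|\cdot\|^2)^*$, and $T$ is $\beta$-cocoercive (thus $\beta^{-1}$-Lipschitz continuous and maximally monotone). (b) Assume that (C2) is satisfied with $\psi$. Then $$T=\nabla\psi=\mathrm{s\text{-}Prox}_{\psi^{*}-(1/2)\|\cdot\|^2},$$ where $\varphi=\psi^{*}-\frac12\|\cdot\|^2$ is $(1-\beta)$-weakly convex.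
   Context: $\Gamma_0(\mathcal{H})$ is the set of proper lower semicontinuous convex functions $\mathcal{H}\to(-\infty,+\infty]$. Single-valued proximity operator: for a proper function $f:\mathcal{H}\to(-\infty,+\infty]$ such that $f+\frac12\|x-\cdot\|^2$ has a unique minimizer for every $x\in\mathcal{H}$, define $\mathrm{s\text{-}Prox}_f(x):=\operatorname{argmin}_{y\in\mathcal{H}}\big(f(y)+\frac12\|x-y\|^2\big)$. (The equality $T=\mathrm{s\text{-}Prox}_\varphi$ includes the assertion that this operator is well defined.) Fenchel conjugate: $f^*(x):=\sup_{y\in\mathcal{H}}[\langle x,y\rangle-f(y)]$. Moreau envelope of $f\in\Gamma_0(\mathcal{H})$ of index $\gamma>0$: ${}^{\gamma}f(x):=\min_{y\in\mathcal{H}}\big(f(y)+\frac{1}{2\gamma}\|x-y\|^2\big)$. An operator $N:\mathcal{H}\to\mathcal{H}$ is nonexpansive if it is $1$-Lipschitz; firmly nonexpansive means of the form $\frac12\mathrm{Id}+\frac12N$ with $N$ nonexpansive; $T$ is $\beta$-cocoercive if $\beta T$ is firmly nonexpansive. For $\rho>0$, $f$ is $\rho$-weakly convex if $f+\frac{\rho}{2}\|\cdot\|^2$ is convex. In (C2), $\psi:\mathcal{H}\to\mathbb{R}$ is Fréchet differentiable on all of $\mathcal{H}$ and $\nabla\psi$ is its gradient. An operator satisfying (C2) for some $\beta\in(0,1)$ is called a monotone Lipschitz-gradient (MoL-Grad) denoiser. Maximally monotone: monotone with graph not properly contained in the graph of another monotone set-valued operator. *)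

theory Defs
  imports "HOL-Analysis.Analysis"
begin

text \<open>
  Functions \<open>H \<rightarrow> [-\<infinity>, +\<infinity>]\<close> on a real Hilbert space are maps into \<^typ>\<open>ereal\<close>.
  In \<^typ>\<open>ereal\<close> one has \<open>\<infinity> + (-\<infinity>) = \<infinity>\<close>; convexity in the sense below is only
  meaningful, and only used, for functions that avoid the value \<open>-\<infinity>\<close>.
\<close>

definition proper_fun :: "('a \<Rightarrow> ereal) \<Rightarrow> bool" where
  "proper_fun f \<longleftrightarrow> (\<forall>x. f x \<noteq> -\<infinity>) \<and> (\<exists>x. f x \<noteq> \<infinity>)"

definition convex_fun :: "('a::real_vector \<Rightarrow> ereal) \<Rightarrow> bool" where
  "convex_fun f \<longleftrightarrow>
    (\<forall>x y. \<forall>t\<in>{0<..<1::real}.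
      f ((1 - t) *\<^sub>R x + t *\<^sub>R y) \<le> ereal (1 - t) * f x + ereal t * f y)"

definition lsc_fun :: "('a::topological_space \<Rightarrow> ereal) \<Rightarrow> bool" where
  "lsc_fun f \<longleftrightarrow> (\<forall>x. f x \<le> Liminf (nhds x) f)"

definition Gamma0 :: "('a::real_normed_vector \<Rightarrow> ereal) set" where
  "Gamma0 = {f. proper_fun f \<and> lsc_fun f \<and> convex_fun f}"

definition weakly_convex :: "real \<Rightarrow> ('a::real_normed_vector \<Rightarrow> ereal) \<Rightarrow> bool" where
  "weakly_convex \<rho> f \<longleftrightarrow> convex_fun (\<lambda>x. f x + ereal (\<rho> / 2 * (norm x)\<^sup>2))"

definition fenchel_conj :: "('a::real_inner \<Rightarrow> ereal) \<Rightarrow> 'a \<Rightarrow> ereal" where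
  "fenchel_conj f x = (SUP y. ereal (x \<bullet> y) - f y)"

text \<open>
  The Moreau envelope is a minimum, not merely an infimum: the value below is meaningful only
  where the minimum is attained, as is the case for every \<open>f \<in> Gamma0\<close> on a Hilbert space and
  every \<open>\<gamma> > 0\<close>.
\<close>

definition moreau_env :: "real \<Rightarrow> ('a::real_normed_vector \<Rightarrow> ereal) \<Rightarrow> 'a \<Rightarrow> ereal" where
  "moreau_env \<gamma> f x =
    (LEAST v. v \<in> range (\<lambda>y. f y + ereal (1 / (2 * \<gamma>) * (norm (x - y))\<^sup>2)))"

definition prox_obj :: "('a::real_normed_vector \<Rightarrow> ereal) \<Rightarrow> 'a \<Rightarrow> 'a \<Rightarrow> ereal" where
  "prox_obj f x y = f y + ereal (1 / 2 * (norm (x - y))\<^sup>2)"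

definition sProx :: "('a::real_normed_vector \<Rightarrow> ereal) \<Rightarrow> 'a \<Rightarrow> 'a" where
  "sProx f x = arg_min (prox_obj f x) (\<lambda>_. True)"

text \<open>
  The operator \<^const>\<open>sProx\<close> is only defined under the following condition, which is therefore
  part of every assertion \<open>T = sProx f\<close>.
\<close>

definition sProx_welldef :: "('a::real_normed_vector \<Rightarrow> ereal) \<Rightarrow> bool" where
  "sProx_welldef f \<longleftrightarrow>
    proper_fun f \<and> (\<forall>x. \<exists>!y. is_arg_min (prox_obj f x) (\<lambda>_. True) y)"

definition is_sProx :: "('a::real_normed_vector \<Rightarrow> 'a) \<Rightarrow> ('a \<Rightarrow> ereal) \<Rightarrow> bool" where
  "is_sProx T f \<longleftrightarrow> sProx_welldef f \<and> T = sProx f"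

text \<open>
  \<open>T = \<nabla>f\<close> for a real-valued \<open>f\<close> that is Frechet differentiable everywhere; the extended-valued
  version includes the assertion that \<open>f\<close> is finite everywhere.
\<close>

definition is_gradient :: "('a::real_inner \<Rightarrow> 'a) \<Rightarrow> ('a \<Rightarrow> real) \<Rightarrow> bool" where
  "is_gradient T f \<longleftrightarrow> (\<forall>x. GDERIV f x :> T x)"

definition is_gradient_ereal :: "('a::real_inner \<Rightarrow> 'a) \<Rightarrow> ('a \<Rightarrow> ereal) \<Rightarrow> bool" where
  "is_gradient_ereal T f \<longleftrightarrow>
    (\<forall>x. \<bar>f x\<bar> \<noteq> \<infinity>) \<and> is_gradient T (\<lambda>x. real_of_ereal (f x))"

definition nonexpansive :: "('a::real_normed_vector \<Rightarrow> 'a) \<Rightarrow> bool" where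
  "nonexpansive N \<longleftrightarrow> 1-lipschitz_on UNIV N"

definition firmly_nonexpansive :: "('a::real_normed_vector \<Rightarrow> 'a) \<Rightarrow> bool" where
  "firmly_nonexpansive T \<longleftrightarrow>
    (\<exists>N. nonexpansive N \<and> T = (\<lambda>x. (1 / 2) *\<^sub>R x + (1 / 2) *\<^sub>R N x))"

definition cocoercive :: "real \<Rightarrow> ('a::real_normed_vector \<Rightarrow> 'a) \<Rightarrow> bool" where
  "cocoercive \<beta> T \<longleftrightarrow> firmly_nonexpansive (\<lambda>x. \<beta> *\<^sub>R T x)"

text \<open>Set-valued operators are represented by their graphs.\<close>

definition monotone_graph :: "('a::real_inner \<times> 'a) set \<Rightarrow> bool" where
  "monotone_graph A \<longleftrightarrow>
    (\<forall>(x, u) \<in> A. \<forall>(y, v) \<in> A. 0 \<le> (x - y) \<bullet> (u - v))"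

definition maximally_monotone_graph :: "('a::real_inner \<times> 'a) set \<Rightarrow> bool" where
  "maximally_monotone_graph A \<longleftrightarrow>
    monotone_graph A \<and> \<not> (\<exists>B. monotone_graph B \<and> A \<subset> B)"

definition maximally_monotone :: "('a::real_inner \<Rightarrow> 'a) \<Rightarrow> bool" where
  "maximally_monotone T \<longleftrightarrow> maximally_monotone_graph {(x, T x) | x. True}"

definition sProx_condition ::
    "real \<Rightarrow> ('a::real_normed_vector \<Rightarrow> 'a) \<Rightarrow> ('a \<Rightarrow> ereal) \<Rightarrow> bool" where
  "sProx_condition \<beta> T \<phi> \<longleftrightarrow>
    (\<forall>x. \<phi> x \<noteq> -\<infinity>) \<and>
    (\<lambda>x. \<phi> x + ereal ((1 - \<beta>) / 2 * (norm x)\<^sup>2)) \<in> Gamma0 \<and>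
    is_sProx T \<phi>"

definition convex_potential :: "('a::real_inner \<Rightarrow> 'a) \<Rightarrow> ('a \<Rightarrow> real) \<Rightarrow> bool" where
  "convex_potential T \<psi> \<longleftrightarrow> (\<lambda>x. ereal (\<psi> x)) \<in> Gamma0 \<and> is_gradient T \<psi>"

definition gradient_condition ::
    "real \<Rightarrow> ('a::real_inner \<Rightarrow> 'a) \<Rightarrow> ('a \<Rightarrow> real) \<Rightarrow> bool" where
  "gradient_condition \<beta> T \<psi> \<longleftrightarrow> convex_potential T \<psi> \<and> cocoercive \<beta> T"

end

theory Submission
  imports Defs
begin

text \<open>
  The bridge between the two conditions is the subdifferential. Write \<open>\<phi>c\<close> for
  \<open>\<phi> + (1 - \<beta>)/2 \<parallel>\<cdot>\<parallel>\<^sup>2\<close> and \<open>g\<close> for \<open>\<phi> + 1/2 \<parallel>\<cdot>\<parallel>\<^sup>2 = \<phi>c + \<beta>/2 \<parallel>\<cdot>\<parallel>\<^sup>2\<close>. Expanding the square in the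
  objective shows that \<open>m\<close> is a proximal point of \<open>x\<close> exactly when \<open>x \<in> \<partial>g(m)\<close>
  (\<open>is_arg_min_prox_obj_iff\<close>); so \<open>T = sProx \<phi>\<close> says that \<open>T\<close> is the
  inverse of \<open>\<partial>g\<close>.

  From the proximity operator to the gradient: convexity of \<open>\<phi>c\<close> lets the quadratic be split off,
  \<open>x - \<beta> T x \<in> \<partial>\<phi>c(T x)\<close> (\<open>is_subgradient_remove_square\<close>). Monotonicity of \<open>\<partial>\<phi>c\<close> is then
  literally the \<open>\<beta>\<close>-cocoercivity of \<open>T\<close>. Conjugation turns \<open>x \<in> \<partial>g(T x)\<close> into \<open>T x \<in> \<partial>g\<^sup>*(x)\<close>, and a
  Lipschitz selection of subgradients is a gradient (\<open>is_subgradient_imp_gradient\<close>), so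
  \<open>T = \<nabla>g\<^sup>*\<close>. The point \<open>x - \<beta> T x\<close> also attains the minimum that defines the Moreau envelope of
  \<open>\<phi>c\<^sup>*\<close>, with value \<open>g\<^sup>*(x)\<close> (\<open>moreau_env_fenchel_conj\<close>).

  From the gradient to the proximity operator: put \<open>\<phi> = \<psi>\<^sup>* - 1/2 \<parallel>\<cdot>\<parallel>\<^sup>2\<close>, so that \<open>g = \<psi>\<^sup>*\<close>. The
  Fenchel--Young equality gives \<open>x \<in> \<partial>\<psi>\<^sup>*(m) \<longleftrightarrow> m = \<nabla>\<psi>(x)\<close>. It remains to see that
  \<open>\<psi>\<^sup>* - \<beta>/2 \<parallel>\<cdot>\<parallel>\<^sup>2\<close> is still convex and lower semicontinuous; the descent lemma exhibits it as the
  supremum of the affine functions \<open>y \<mapsto> \<langle>y, x - \<beta> T x\<rangle> - \<psi>(x) + \<beta>/2 \<parallel>T x\<parallel>\<^sup>2\<close>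
  (\<open>fenchel_conj_minus_square_Gamma0\<close>).

  For gradients of convex functions, Lipschitz continuity improves to cocoercivity by comparing a
  gradient step with the minimum of a tilted potential (\<open>baillon_haddad\<close>). Maximal monotonicity is
  Minty's argument for a monotone Lipschitz operator (\<open>lipschitz_monotone_imp_maximally_monotone\<close>).

  Each conjugate that occurs comes with an explicit subgradient, supplied by \<open>T\<close>. Finiteness of the
  conjugate, and biconjugation at the relevant points, are then read off from the Fenchel--Young
  equality.
\<close>

section \<open>Subgradients and conjugates\<close>

text \<open>
  Requiring a finite value at \<open>x\<close> excludes the cases \<open>f x = -\<infinity>\<close> and \<open>f = \<infinity>\<close>, in which the inequality
  would hold for every \<open>u\<close>.
\<close>

definition is_subgradient :: "('a::real_inner \<Rightarrow> ereal) \<Rightarrow> 'a \<Rightarrow> 'a \<Rightarrow> bool" where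
  "is_subgradient f x u \<longleftrightarrow> \<bar>f x\<bar> \<noteq> \<infinity> \<and> (\<forall>y. f x + ereal (u \<bullet> (y - x)) \<le> f y)"

lemma is_subgradient_iff:
  "is_subgradient f x u \<longleftrightarrow> (\<exists>r. f x = ereal r \<and> (\<forall>y. ereal (r + u \<bullet> (y - x)) \<le> f y))"
  unfolding is_subgradient_def by (cases "f x") auto

lemma is_subgradientI:
  assumes "f x = ereal r" and "\<And>y. ereal (r + u \<bullet> (y - x)) \<le> f y"
  shows "is_subgradient f x u"
  using assms unfolding is_subgradient_def by simp

lemma is_subgradient_monotone:
  assumes "is_subgradient f x u" and "is_subgradient f y v"
  shows "0 \<le> (x - y) \<bullet> (u - v)"
proof -
  obtain r where r: "f x = ereal r" "\<And>z. ereal (r + u \<bullet> (z - x)) \<le> f z"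
    using assms(1) unfolding is_subgradient_iff by blast
  obtain s where s: "f y = ereal s" "\<And>z. ereal (s + v \<bullet> (z - y)) \<le> f z"
    using assms(2) unfolding is_subgradient_iff by blast
  have "r + u \<bullet> (y - x) \<le> s" "s + v \<bullet> (x - y) \<le> r"
    using r(2)[of y] s(2)[of x] r(1) s(1) by simp_all
  then show ?thesis by (simp add: inner_diff_left inner_diff_right inner_commute)
qed

lemma fenchel_young: "ereal (x \<bullet> y) - f y \<le> fenchel_conj f x"
  unfolding fenchel_conj_def by (rule SUP_upper) simp

lemma fenchel_conj_subgradient:
  assumes "is_subgradient f x u"
  shows "fenchel_conj f u = ereal (u \<bullet> x) - f x"
proof (rule antisym)
  obtain r where r: "f x = ereal r" "\<And>z. ereal (r + u \<bullet> (z - x)) \<le> f z"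
    using assms unfolding is_subgradient_iff by blast
  have "ereal (u \<bullet> y) - f y \<le> ereal (u \<bullet> x) - f x" for y
    using r(2)[of y] r(1) by (cases "f y") (auto simp: inner_diff_right)
  then show "fenchel_conj f u \<le> ereal (u \<bullet> x) - f x"
    unfolding fenchel_conj_def by (intro SUP_least)
qed (rule fenchel_young)

lemma is_subgradient_fenchel_conj:
  assumes "is_subgradient f x u"
  shows "is_subgradient (fenchel_conj f) u x"
proof -
  obtain r where r: "f x = ereal r" using assms unfolding is_subgradient_iff by blast
  show ?thesis
  proof (rule is_subgradientI)
    show "fenchel_conj f u = ereal (u \<bullet> x - r)"
      using fenchel_conj_subgradient[OF assms] r by simp
    show "ereal (u \<bullet> x - r + x \<bullet> (y - u)) \<le> fenchel_conj f y" for y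
      using fenchel_young[of y x f] r by (simp add: inner_diff_right inner_commute)
  qed
qed

text \<open>
  The subgradient \<open>u\<close> makes \<open>f\<close> agree with its biconjugate at \<open>x\<close>, and at such a point subgradients
  can be pulled back from the conjugate.
\<close>

lemma is_subgradient_of_fenchel_conj:
  assumes "is_subgradient f x u" and "is_subgradient (fenchel_conj f) v x"
  shows "is_subgradient f x v"
proof -
  obtain r where r: "f x = ereal r" using assms(1) unfolding is_subgradient_iff by blast
  obtain s where s: "fenchel_conj f v = ereal s"
      "\<And>z. ereal (s + x \<bullet> (z - v)) \<le> fenchel_conj f z"
    using assms(2) unfolding is_subgradient_iff by blast
  \<comment> \<open>Testing the subgradient inequality of the conjugate at \<open>u\<close> gives the nontrivial half of the Fenchel--Young equality at \<open>(x, v)\<close>.\<close>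
  have conj_le: "s \<le> v \<bullet> x - r"
    using s(2)[of u] fenchel_conj_subgradient[OF assms(1)] r
    by (simp add: inner_diff_right inner_commute)
  show ?thesis
  proof (rule is_subgradientI[where r = r])
    show "ereal (r + v \<bullet> (y - x)) \<le> f y" for y
      using fenchel_young[of v y f] s(1) conj_le
      by (cases "f y") (auto simp: inner_diff_right)
  qed (rule r)
qed

text \<open>
  All memberships in \<^const>\<open>Gamma0\<close> that have to be proved are instances of this lemma: convexity
  and lower semicontinuity are inherited by suprema, and an affine function has both.
\<close>

lemma SUP_affine_Gamma0:
  fixes a :: "'i \<Rightarrow> 'a::real_inner"
  assumes f: "\<And>x. f x = (SUP i\<in>I. ereal (x \<bullet> a i + b i))"
    and "I \<noteq> {}" and "f x0 \<noteq> \<infinity>"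
  shows "f \<in> Gamma0"
proof -
  have upper: "ereal (x \<bullet> a i + b i) \<le> f x" if "i \<in> I" for x i
    unfolding f using that by (rule SUP_upper)
  obtain j where "j \<in> I" using \<open>I \<noteq> {}\<close> by blast
  then have not_MInf: "f x \<noteq> -\<infinity>" for x
    using upper[of j x] by auto
  have "convex_fun f"
    unfolding convex_fun_def
  proof (intro allI ballI)
    fix x y :: 'a and t :: real
    assume t: "t \<in> {0<..<1}"
    show "f ((1 - t) *\<^sub>R x + t *\<^sub>R y) \<le> ereal (1 - t) * f x + ereal t * f y"
    proof (cases "f x = \<infinity> \<or> f y = \<infinity>")
      case True
      then show ?thesis using t not_MInf[of x] not_MInf[of y]
        by (cases "f x"; cases "f y") auto
    next
      case False
      then obtain r s where rs: "f x = ereal r" "f y = ereal s"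
        using not_MInf[of x] not_MInf[of y] by (cases "f x"; cases "f y") auto
      have "ereal (((1 - t) *\<^sub>R x + t *\<^sub>R y) \<bullet> a i + b i) \<le> ereal ((1 - t) * r + t * s)"
        if "i \<in> I" for i
      proof -
        have "x \<bullet> a i + b i \<le> r" "y \<bullet> a i + b i \<le> s"
          using upper[OF that, of x] upper[OF that, of y] rs by auto
        then have "(1 - t) * (x \<bullet> a i + b i) + t * (y \<bullet> a i + b i) \<le> (1 - t) * r + t * s"
          using t by (intro add_mono mult_left_mono) auto
        then show ?thesis by (simp add: algebra_simps)
      qed
      then show ?thesis unfolding f[of "(1 - t) *\<^sub>R x + t *\<^sub>R y"] using rs
        by (intro SUP_least) simp
    qed
  qed
  moreover have "lsc_fun f"
    unfolding lsc_fun_def le_Liminf_iff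
  proof (intro allI impI)
    fix x y
    assume "y < f x"
    then obtain i where i: "i \<in> I" "y < ereal (x \<bullet> a i + b i)"
      unfolding f less_SUP_iff by blast
    have "((\<lambda>z. ereal (z \<bullet> a i + b i)) \<longlongrightarrow> ereal (x \<bullet> a i + b i)) (nhds x)"
      by (intro tendsto_intros filterlim_ident)
    then have "\<forall>\<^sub>F z in nhds x. y < ereal (z \<bullet> a i + b i)"
      using i(2) by (rule order_tendstoD)
    then show "\<forall>\<^sub>F z in nhds x. y < f z"
      by eventually_elim (use upper[OF i(1)] less_le_trans in blast)
  qed
  ultimately show ?thesis
    using not_MInf \<open>f x0 \<noteq> \<infinity>\<close> unfolding Gamma0_def proper_fun_def by blast
qed

text \<open>
  A subgradient is an affine minorant of \<open>f\<close>, which is what keeps the conjugate from being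
  identically \<open>\<infinity>\<close>.
\<close>

lemma fenchel_conj_Gamma0:
  assumes "is_subgradient f x u" and "proper_fun f"
  shows "fenchel_conj f \<in> Gamma0"
proof (rule SUP_affine_Gamma0)
  \<comment> \<open>Points where \<open>f\<close> is infinite contribute \<open>-\<infinity>\<close> to the supremum; without them all slopes and intercepts are real.\<close>
  let ?I = "{y. f y \<noteq> \<infinity>}"
  show "fenchel_conj f z = (SUP y\<in>?I. ereal (z \<bullet> y + - real_of_ereal (f y)))" for z
    unfolding fenchel_conj_def
  proof (rule antisym)
    show "(SUP y. ereal (z \<bullet> y) - f y) \<le> (SUP y\<in>?I. ereal (z \<bullet> y + - real_of_ereal (f y)))"
    proof (rule SUP_least)
      fix y
      show "ereal (z \<bullet> y) - f y \<le> (SUP y\<in>?I. ereal (z \<bullet> y + - real_of_ereal (f y)))"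
      proof (cases "f y")
        case (real r)
        then show ?thesis by (intro SUP_upper2[of y]) auto
      qed (use assms(2) in \<open>auto simp: proper_fun_def\<close>)
    qed
    show "(SUP y\<in>?I. ereal (z \<bullet> y + - real_of_ereal (f y))) \<le> (SUP y. ereal (z \<bullet> y) - f y)"
    proof (rule SUP_least)
      fix y assume "y \<in> ?I"
      then obtain r where "f y = ereal r"
        using assms(2) by (cases "f y") (auto simp: proper_fun_def)
      then show "ereal (z \<bullet> y + - real_of_ereal (f y)) \<le> (SUP y. ereal (z \<bullet> y) - f y)"
        by (intro SUP_upper2[of y]) auto
    qed
  qed
  show "?I \<noteq> {}" using assms(2) by (auto simp: proper_fun_def)
  show "fenchel_conj f u \<noteq> \<infinity>"
    using is_subgradient_fenchel_conj[OF assms(1)] by (auto simp: is_subgradient_def)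
qed

section \<open>Proximity operators as inverse subdifferentials\<close>

text \<open>
  Fermat's rule. The objective differs from \<open>\<phi>(y) + 1/2 \<parallel>y\<parallel>\<^sup>2 - \<langle>x, y\<rangle>\<close> only by the constant
  \<open>1/2 \<parallel>x\<parallel>\<^sup>2\<close>.
\<close>

lemma is_arg_min_prox_obj_iff:
  assumes "proper_fun \<phi>"
  shows "is_arg_min (prox_obj \<phi> x) (\<lambda>_. True) m \<longleftrightarrow>
    is_subgradient (\<lambda>y. \<phi> y + ereal (1 / 2 * (norm y)\<^sup>2)) m x"
    (is "_ \<longleftrightarrow> is_subgradient ?g m x")
proof -
  have split: "1 / 2 * (norm (x - y))\<^sup>2 = 1 / 2 * (norm y)\<^sup>2 + 1 / 2 * (norm x)\<^sup>2 - x \<bullet> y" for y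
    by (simp add: power2_norm_eq_inner inner_diff_left inner_diff_right inner_commute)
  have obj: "prox_obj \<phi> x m \<le> prox_obj \<phi> x y \<longleftrightarrow> ?g m + ereal (x \<bullet> (y - m)) \<le> ?g y" for y
    unfolding prox_obj_def split
    by (cases "\<phi> m"; cases "\<phi> y") (auto simp: inner_diff_right)
  \<comment> \<open>The subgradient relation asks for a finite value at \<open>m\<close>; a point of the domain of \<open>\<phi>\<close> forces it.\<close>
  obtain y0 where y0: "\<phi> y0 \<noteq> \<infinity>" using assms by (auto simp: proper_fun_def)
  have "\<phi> m \<noteq> \<infinity>" if "prox_obj \<phi> x m \<le> prox_obj \<phi> x y0"
    using that y0 by (cases "\<phi> y0") (auto simp: prox_obj_def)
  then have fin: "\<bar>?g m\<bar> \<noteq> \<infinity>" if "prox_obj \<phi> x m \<le> prox_obj \<phi> x y0"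
    using that assms by (cases "\<phi> m") (auto simp: proper_fun_def)
  show ?thesis
    unfolding is_arg_min_def is_subgradient_def obj[symmetric]
    using fin by (auto simp: not_less)
qed

lemma is_sProx_iff:
  "is_sProx T \<phi> \<longleftrightarrow>
    proper_fun \<phi> \<and>
    (\<forall>x m. is_subgradient (\<lambda>y. \<phi> y + ereal (1 / 2 * (norm y)\<^sup>2)) m x \<longleftrightarrow> m = T x)"
proof (cases "proper_fun \<phi>")
  case True
  have "is_sProx T \<phi> \<longleftrightarrow> (\<forall>x m. is_arg_min (prox_obj \<phi> x) (\<lambda>_. True) m \<longleftrightarrow> m = T x)"
    (is "_ \<longleftrightarrow> (\<forall>x m. ?P x m \<longleftrightarrow> m = T x)")
  proof
    assume s: "is_sProx T \<phi>"
    then have "\<exists>!m. ?P x m" and "T x = (SOME m. ?P x m)" for x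
      by (auto simp: is_sProx_def sProx_welldef_def sProx_def arg_min_def)
    then show "\<forall>x m. ?P x m \<longleftrightarrow> m = T x" by (metis someI_ex)
  next
    assume r: "\<forall>x m. ?P x m \<longleftrightarrow> m = T x"
    then have "T x = sProx \<phi> x" for x
      unfolding sProx_def arg_min_def by (intro some_equality[symmetric]) auto
    then show "is_sProx T \<phi>" using r True
      by (auto simp: is_sProx_def sProx_welldef_def fun_eq_iff)
  qed
  then show ?thesis using True by (simp add: is_arg_min_prox_obj_iff)
qed (simp add: is_sProx_def sProx_welldef_def)

text \<open>
  The subgradient inequality for \<open>f + \<beta>/2 \<parallel>\<cdot>\<parallel>\<^sup>2\<close> yields the one for \<open>f\<close> up to an error that is quadratic
  in \<open>y - m\<close>. By convexity, the increment of \<open>f\<close> from \<open>m\<close> to the point at parameter \<open>t\<close> of the segment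
  towards \<open>y\<close> is at most \<open>t\<close> times the full increment; after division by \<open>t\<close> the error is of order
  \<open>t\<close> and vanishes in the limit.
\<close>

lemma is_subgradient_remove_square:
  fixes f :: "'a::real_inner \<Rightarrow> ereal"
  assumes "convex_fun f"
    and "is_subgradient (\<lambda>y. f y + ereal (\<beta> / 2 * (norm y)\<^sup>2)) m x"
  shows "is_subgradient f m (x - \<beta> *\<^sub>R m)"
proof -
  let ?q = "\<lambda>y::'a. \<beta> / 2 * (norm y)\<^sup>2"
  obtain r where r: "f m = ereal r"
    using assms(2) by (cases "f m") (auto simp: is_subgradient_def)
  have sub: "ereal (r + ?q m + x \<bullet> (y - m)) \<le> f y + ereal (?q y)" for y
    using assms(2) r by (auto simp: is_subgradient_def)
  have "ereal (r + (x - \<beta> *\<^sub>R m) \<bullet> (y - m)) \<le> f y" for y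
  proof (cases "f y")
    case (real s)
    let ?d = "y - m"
    have along: "s - r \<ge> (x - \<beta> *\<^sub>R m) \<bullet> ?d - t * (\<beta> / 2 * (norm ?d)\<^sup>2)"
      if t: "t \<in> {0<..<1}" for t
    proof -
      let ?w = "(1 - t) *\<^sub>R m + t *\<^sub>R y"
      have w: "?w = m + t *\<^sub>R ?d" by (simp add: algebra_simps)
      have "f ?w \<le> ereal ((1 - t) * r + t * s)"
        using assms(1)[unfolded convex_fun_def, rule_format, OF t, of m y] r real by simp
      with sub[of ?w] have "r + ?q m + x \<bullet> (?w - m) \<le> (1 - t) * r + t * s + ?q ?w"
        by (cases "f ?w") auto
      moreover have "x \<bullet> (?w - m) = t * (x \<bullet> ?d)" unfolding w by simp
      moreover have "?q ?w = ?q m + t * (\<beta> * (m \<bullet> ?d)) + t * (t * (\<beta> / 2 * (norm ?d)\<^sup>2))"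
        unfolding w power2_norm_eq_inner inner_add_left inner_add_right inner_scaleR_left
          inner_scaleR_right inner_commute[of "y - m" m]
        by (simp add: field_simps)
      ultimately have "t * (x \<bullet> ?d - \<beta> * (m \<bullet> ?d) - t * (\<beta> / 2 * (norm ?d)\<^sup>2)) \<le> t * (s - r)"
        by (simp only: ring_distribs)
      then show ?thesis using t by (simp add: inner_diff_left)
    qed
    have "\<forall>\<^sub>F t in at_right (0::real). (x - \<beta> *\<^sub>R m) \<bullet> ?d - t * (\<beta> / 2 * (norm ?d)\<^sup>2) \<le> s - r"
      using eventually_at_right_real[OF zero_less_one] by (rule eventually_mono) (rule along)
    moreover have "((\<lambda>t. (x - \<beta> *\<^sub>R m) \<bullet> ?d - t * (\<beta> / 2 * (norm ?d)\<^sup>2)) \<longlongrightarrow>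
        (x - \<beta> *\<^sub>R m) \<bullet> ?d - 0 * (\<beta> / 2 * (norm ?d)\<^sup>2)) (at_right 0)"
      by (intro tendsto_intros)
    ultimately have "(x - \<beta> *\<^sub>R m) \<bullet> ?d - 0 * (\<beta> / 2 * (norm ?d)\<^sup>2) \<le> s - r"
      by (intro tendsto_upperbound[OF _ _ trivial_limit_at_right_real])
    then show ?thesis using real by simp
  qed (use sub[of y] in auto)
  with r show ?thesis by (rule is_subgradientI)
qed

text \<open>
  Two subgradient inequalities, at \<open>x\<close> and at \<open>y\<close>, enclose the first-order error
  \<open>f(y) - f(x) - \<langle>T x, y - x\<rangle>\<close> between \<open>0\<close> and \<open>\<langle>T y - T x, y - x\<rangle>\<close>, which the Lipschitz condition makes
  quadratic in \<open>y - x\<close>.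
\<close>

lemma is_subgradient_imp_gradient:
  assumes "\<And>x. is_subgradient f x (T x)" and L: "L-lipschitz_on UNIV T"
  shows "is_gradient_ereal T f"
proof -
  have fin: "\<bar>f x\<bar> \<noteq> \<infinity>" for x using assms(1)[of x] by (simp add: is_subgradient_def)
  define F where "F x = real_of_ereal (f x)" for x
  have fF: "f x = ereal (F x)" for x using fin[of x] by (simp add: F_def ereal_real')
  have sub: "F x + T x \<bullet> (y - x) \<le> F y" for x y
    using assms(1)[of x] by (simp add: is_subgradient_def fF)
  have bound: "\<bar>F y - F x - T x \<bullet> (y - x)\<bar> \<le> L * norm (y - x) * norm (y - x)" for x y
  proof -
    have "F y - F x - T x \<bullet> (y - x) \<le> (T y - T x) \<bullet> (y - x)"
      using sub[of y x] by (simp add: inner_diff_left inner_diff_right)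
    also have "\<dots> \<le> norm (T y - T x) * norm (y - x)" by (rule norm_cauchy_schwarz)
    also have "\<dots> \<le> L * norm (y - x) * norm (y - x)"
      using lipschitz_onD[OF L, of y x] by (intro mult_right_mono) (auto simp: dist_norm)
    finally show ?thesis using sub[of x y] by simp
  qed
  have "GDERIV F x :> T x" for x
    unfolding gderiv_def has_derivative_at2
  proof (intro conjI)
    show "bounded_linear (\<lambda>h. h \<bullet> T x)" by (rule bounded_linear_inner_left)
    have "((\<lambda>y. L * norm (y - x)) \<longlongrightarrow> L * norm (x - x)) (at x)"
      by (intro tendsto_intros)
    then have lim: "((\<lambda>y. L * norm (y - x)) \<longlongrightarrow> 0) (at x)" by simp
    have "\<forall>\<^sub>F y in at x. norm ((1 / norm (y - x)) *\<^sub>R (F y - (F x + (y - x) \<bullet> T x))) \<le> L * norm (y - x)"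
      unfolding eventually_at_filter
    proof (rule always_eventually, intro allI impI)
      fix y assume "y \<noteq> x"
      then show "norm ((1 / norm (y - x)) *\<^sub>R (F y - (F x + (y - x) \<bullet> T x))) \<le> L * norm (y - x)"
        using bound[of y x] by (simp add: inner_commute diff_diff_eq pos_divide_le_eq)
    qed
    then show "((\<lambda>y. (1 / norm (y - x)) *\<^sub>R (F y - (F x + (y - x) \<bullet> T x))) \<longlongrightarrow> 0) (at x)"
      using lim by (rule Lim_null_comparison)
  qed
  then show ?thesis using fin by (simp add: is_gradient_ereal_def is_gradient_def F_def[abs_def])
qed

text \<open>
  The lower bound comes from the Fenchel--Young inequality at \<open>m\<close>, followed by completing the square
  in \<open>y\<close>. Both steps are equalities at \<open>y = x - \<beta> m\<close>, so the minimum is attained there. By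
  \<open>fenchel_conj_subgradient\<close> the right-hand side is the conjugate of \<open>f + \<beta>/2 \<parallel>\<cdot>\<parallel>\<^sup>2\<close> at \<open>x\<close> whenever
  \<open>x\<close> is a subgradient of that function at \<open>m\<close>.
\<close>

lemma moreau_env_fenchel_conj:
  fixes f :: "'a::real_inner \<Rightarrow> ereal"
  assumes "0 < \<beta>" and sub: "is_subgradient f m (x - \<beta> *\<^sub>R m)"
  shows "moreau_env \<beta> (fenchel_conj f) x = ereal (x \<bullet> m) - (f m + ereal (\<beta> / 2 * (norm m)\<^sup>2))"
proof -
  obtain r where r: "f m = ereal r" using sub unfolding is_subgradient_iff by blast
  let ?v = "x \<bullet> m - r - \<beta> / 2 * (norm m)\<^sup>2"
  let ?h = "\<lambda>y. fenchel_conj f y + ereal (1 / (2 * \<beta>) * (norm (x - y))\<^sup>2)"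
  have "ereal ?v = ?h (x - \<beta> *\<^sub>R m)"
    using fenchel_conj_subgradient[OF sub] r \<open>0 < \<beta>\<close>
    by (simp add: inner_diff_left power_mult_distrib power2_norm_eq_inner[symmetric])
       (simp add: power2_eq_square field_simps)
  moreover have "ereal ?v \<le> ?h y" for y
  proof -
    have "0 \<le> 1 / (2 * \<beta>) * (norm (x - y - \<beta> *\<^sub>R m))\<^sup>2" using \<open>0 < \<beta>\<close> by simp
    also have "(norm (x - y - \<beta> *\<^sub>R m))\<^sup>2
        = (norm (x - y))\<^sup>2 - 2 * \<beta> * ((x - y) \<bullet> m) + \<beta>\<^sup>2 * (norm m)\<^sup>2"
      unfolding power2_norm_eq_inner inner_diff_left[of "x - y" "\<beta> *\<^sub>R m"]
        inner_diff_right[of _ "x - y" "\<beta> *\<^sub>R m"]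
      by (simp add: inner_commute power2_eq_square)
    also have "1 / (2 * \<beta>) * \<dots>
        = 1 / (2 * \<beta>) * (norm (x - y))\<^sup>2 - (x - y) \<bullet> m + \<beta> / 2 * (norm m)\<^sup>2"
      using \<open>0 < \<beta>\<close> by (simp add: field_simps power2_eq_square)
    finally have "?v \<le> (y \<bullet> m - r) + 1 / (2 * \<beta>) * (norm (x - y))\<^sup>2"
      by (simp add: inner_diff_left)
    moreover have "ereal (y \<bullet> m - r) \<le> fenchel_conj f y"
      using fenchel_young[of y m f] r by simp
    ultimately show ?thesis by (cases "fenchel_conj f y") auto
  qed
  ultimately have "moreau_env \<beta> (fenchel_conj f) x = ereal ?v"
    unfolding moreau_env_def by (intro Least_equality) (blast intro: rangeI, blast)
  then show ?thesis using r by simp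
qed

section \<open>Cocoercive and maximally monotone operators\<close>

text \<open>
  The only candidate for the nonexpansive operator is the reflection \<open>2\<beta>T - Id\<close>. Expanding
  \<open>\<parallel>2\<beta>(T x - T y) - (x - y)\<parallel>\<^sup>2\<close>, the term \<open>\<parallel>x - y\<parallel>\<^sup>2\<close> cancels against the nonexpansiveness bound.
\<close>

lemma cocoercive_iff:
  fixes T :: "'a::real_inner \<Rightarrow> 'a"
  assumes "0 < \<beta>"
  shows "cocoercive \<beta> T \<longleftrightarrow> (\<forall>x y. \<beta> * (norm (T x - T y))\<^sup>2 \<le> (x - y) \<bullet> (T x - T y))"
proof -
  let ?N = "\<lambda>x. (2 * \<beta>) *\<^sub>R T x - x"
  have N: "(\<lambda>x. \<beta> *\<^sub>R T x) = (\<lambda>x. (1 / 2) *\<^sub>R x + (1 / 2) *\<^sub>R M x) \<longleftrightarrow> M = ?N" for M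
  proof -
    have "\<beta> *\<^sub>R T x = (1 / 2) *\<^sub>R x + (1 / 2) *\<^sub>R M x \<longleftrightarrow> M x = ?N x" for x
    proof
      assume "\<beta> *\<^sub>R T x = (1 / 2) *\<^sub>R x + (1 / 2) *\<^sub>R M x"
      then have "2 *\<^sub>R (\<beta> *\<^sub>R T x) = 2 *\<^sub>R ((1 / 2) *\<^sub>R x + (1 / 2) *\<^sub>R M x)" by simp
      then show "M x = ?N x" by (simp add: scaleR_add_right)
    qed (simp add: scaleR_diff_right)
    then show ?thesis by (auto simp: fun_eq_iff)
  qed
  have "norm (?N x - ?N y) \<le> norm (x - y) \<longleftrightarrow>
      \<beta> * (norm (T x - T y))\<^sup>2 \<le> (x - y) \<bullet> (T x - T y)" for x y
  proof -
    have "?N x - ?N y = (2 * \<beta>) *\<^sub>R (T x - T y) - (x - y)" by (simp add: algebra_simps)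
    then have "(norm (?N x - ?N y))\<^sup>2 = (norm ((2 * \<beta>) *\<^sub>R (T x - T y) - (x - y)))\<^sup>2"
      by (rule arg_cong)
    also have "\<dots> = (norm (x - y))\<^sup>2
        + 4 * \<beta> * (\<beta> * (norm (T x - T y))\<^sup>2 - (x - y) \<bullet> (T x - T y))"
      unfolding power2_norm_eq_inner inner_diff_left[of "(2 * \<beta>) *\<^sub>R (T x - T y)" "x - y"]
        inner_diff_right[of _ "(2 * \<beta>) *\<^sub>R (T x - T y)" "x - y"]
      by (simp only: inner_scaleR_left inner_scaleR_right inner_commute[of "T x - T y" "x - y"])
         (simp add: algebra_simps)
    finally show ?thesis using \<open>0 < \<beta>\<close>
      by (simp add: norm_le_square abs_le_square_iff[symmetric] norm_le mult_le_0_iff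
          power2_norm_eq_inner)
  qed
  then have "nonexpansive ?N \<longleftrightarrow> (\<forall>x y. \<beta> * (norm (T x - T y))\<^sup>2 \<le> (x - y) \<bullet> (T x - T y))"
    unfolding nonexpansive_def lipschitz_on_def dist_norm by simp
  then show ?thesis
    unfolding cocoercive_def firmly_nonexpansive_def N by simp
qed

lemma cocoercive_imp_lipschitz:
  fixes T :: "'a::real_inner \<Rightarrow> 'a"
  assumes "0 < \<beta>" and "cocoercive \<beta> T"
  shows "(1 / \<beta>)-lipschitz_on UNIV T"
proof (rule lipschitz_onI)
  fix x y
  have "\<beta> * (norm (T x - T y))\<^sup>2 \<le> (x - y) \<bullet> (T x - T y)"
    using assms by (simp add: cocoercive_iff)
  also have "\<dots> \<le> norm (x - y) * norm (T x - T y)" by (rule norm_cauchy_schwarz)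
  finally have "\<beta> * norm (T x - T y) \<le> norm (x - y)"
    by (cases "T x = T y") (auto simp: power2_eq_square)
  then show "dist (T x) (T y) \<le> 1 / \<beta> * dist x y"
    using \<open>0 < \<beta>\<close> by (simp add: dist_norm field_simps)
qed (use assms in simp)

text \<open>
  Minty's argument: if \<open>(y, v)\<close> is monotonically related to the graph of \<open>T\<close>, test it against the
  points \<open>y - t(T y - v)\<close>. By the Lipschitz bound, a single small
  step length already forces \<open>v = T y\<close>.
\<close>

lemma lipschitz_monotone_imp_maximally_monotone:
  assumes L: "L-lipschitz_on UNIV T" and "0 < L"
    and mono: "\<And>x y. 0 \<le> (x - y) \<bullet> (T x - T y)"
  shows "maximally_monotone T"
  unfolding maximally_monotone_def maximally_monotone_graph_def
proof (intro conjI notI)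
  show "monotone_graph {(x, T x) | x. True}"
    using mono by (auto simp: monotone_graph_def)
  assume "\<exists>B. monotone_graph B \<and> {(x, T x) | x. True} \<subset> B"
  then obtain B where B: "monotone_graph B" "{(x, T x) | x. True} \<subset> B" by blast
  then obtain p where "p \<in> B" "p \<notin> {(x, T x) | x. True}" by blast
  then obtain y v where yv: "(y, v) \<in> B" "v \<noteq> T y" by (cases p) auto
  define w where "w = T y - v"
  \<comment> \<open>Any \<open>t < 1 / L\<close> leads to \<open>\<parallel>w\<parallel>\<^sup>2 \<le> t L \<parallel>w\<parallel>\<^sup>2\<close> with \<open>t L < 1\<close>.\<close>
  define t where "t = 1 / (2 * L)"
  have t: "0 < t" using \<open>0 < L\<close> by (simp add: t_def)
  have "(y - t *\<^sub>R w, T (y - t *\<^sub>R w)) \<in> B" using psubset_imp_subset[OF B(2)] by blast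
  then have "0 \<le> (y - (y - t *\<^sub>R w)) \<bullet> (v - T (y - t *\<^sub>R w))"
    using B(1) yv(1) unfolding monotone_graph_def by fast
  then have "0 \<le> w \<bullet> (v - T (y - t *\<^sub>R w))"
    using t by (simp add: zero_le_mult_iff)
  also have "\<dots> = w \<bullet> (T y - T (y - t *\<^sub>R w)) - (norm w)\<^sup>2"
    unfolding w_def power2_norm_eq_inner by (simp add: inner_diff_right)
  finally have "(norm w)\<^sup>2 \<le> norm w * norm (T y - T (y - t *\<^sub>R w))"
    using norm_cauchy_schwarz[of w "T y - T (y - t *\<^sub>R w)"] by linarith
  also have "\<dots> \<le> norm w * (L * norm (t *\<^sub>R w))"
    using lipschitz_onD[OF L, of y "y - t *\<^sub>R w"] by (intro mult_left_mono) (auto simp: dist_norm)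
  also have "\<dots> = (norm w)\<^sup>2 / 2"
    using t \<open>0 < L\<close> by (simp add: power2_eq_square t_def)
  finally have "w = 0" by simp
  then show False using yv(2) by (simp add: w_def)
qed

section \<open>Convex functions with Lipschitz gradient\<close>

lemma has_real_derivative_along_line:
  assumes "is_gradient T \<psi>"
  shows "((\<lambda>t. \<psi> (x + t *\<^sub>R d)) has_real_derivative d \<bullet> T (x + t *\<^sub>R d)) (at t)"
proof -
  have "(\<psi> has_derivative (\<lambda>h. h \<bullet> T (x + t *\<^sub>R d))) (at (x + t *\<^sub>R d))"
    using assms by (simp add: is_gradient_def gderiv_def)
  moreover have "((\<lambda>t. x + t *\<^sub>R d) has_derivative (\<lambda>s. s *\<^sub>R d)) (at t)"
    by (auto intro!: derivative_eq_intros)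
  ultimately have "((\<lambda>t. \<psi> (x + t *\<^sub>R d)) has_derivative (\<lambda>s. (s *\<^sub>R d) \<bullet> T (x + t *\<^sub>R d))) (at t)"
    by (rule has_derivative_compose[rotated])
  then show ?thesis
    by (simp add: has_field_derivative_def mult_commute_abs)
qed

lemma convex_potential_is_subgradient:
  assumes "convex_potential T \<psi>"
  shows "is_subgradient (\<lambda>x. ereal (\<psi> x)) x (T x)"
proof (rule is_subgradientI[OF refl])
  fix y
  let ?g = "\<lambda>t. \<psi> (x + t *\<^sub>R (y - x))"
  have grad: "is_gradient T \<psi>" and conv: "convex_fun (\<lambda>x. ereal (\<psi> x))"
    using assms by (auto simp: convex_potential_def Gamma0_def)
  have chord: "?g ((1 - t) * a + t * b) \<le> (1 - t) * ?g a + t * ?g b"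
    if "0 < t" "t < 1" for t a b
  proof -
    have "x + ((1 - t) * a + t * b) *\<^sub>R (y - x)
        = (1 - t) *\<^sub>R (x + a *\<^sub>R (y - x)) + t *\<^sub>R (x + b *\<^sub>R (y - x))"
      by (simp add: algebra_simps)
    then show ?thesis
      using conv that unfolding convex_fun_def by (simp add: Ball_def)
  qed
  have "convex_on UNIV ?g"
    by (rule convex_onI) (use chord in \<open>auto simp: real_scaleR_def\<close>)
  then have "?g 1 - ?g 0 \<ge> ((y - x) \<bullet> T (x + 0 *\<^sub>R (y - x))) * (1 - 0)"
    by (rule convex_on_imp_above_tangent) (use has_real_derivative_along_line[OF grad, of x "y - x" 0] in auto)
  then show "ereal (\<psi> x + T x \<bullet> (y - x)) \<le> ereal (\<psi> y)"
    by (simp add: inner_commute)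
qed

text \<open>
  A subgradient \<open>u\<close> at \<open>x\<close> makes \<open>x\<close> a global minimizer of \<open>z \<mapsto> \<psi>(z) - \<langle>z, u\<rangle>\<close>, whose derivative
  therefore vanishes at \<open>x\<close>.
\<close>

lemma is_subgradient_unique_gradient:
  assumes "is_gradient T \<psi>" and "is_subgradient (\<lambda>x. ereal (\<psi> x)) x u"
  shows "u = T x"
proof -
  have d: "((\<lambda>z. \<psi> z - z \<bullet> u) has_derivative (\<lambda>h. h \<bullet> T x - h \<bullet> u)) (at x)"
    using assms(1) unfolding is_gradient_def gderiv_def
    by (intro has_derivative_diff) (auto intro!: derivative_eq_intros)
  have "\<psi> x - x \<bullet> u \<le> \<psi> z - z \<bullet> u" for z
    using assms(2) by (auto simp: is_subgradient_def inner_diff_right inner_commute dest: spec[of _ z])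
  then have "(\<lambda>h. h \<bullet> T x - h \<bullet> u) = (\<lambda>h. 0)"
    using d by (intro differential_zero_maxmin[of x UNIV, OF _ _ d]) auto
  then have "(T x - u) \<bullet> T x - (T x - u) \<bullet> u = 0" by (rule fun_cong)
  then show ?thesis by (simp flip: inner_diff_right)
qed

text \<open>
  The gap between the two sides is monotone along the segment from \<open>x\<close> to \<open>y\<close>: at parameter \<open>t\<close> the
  Lipschitz condition bounds the derivative of the first-order error by \<open>L t \<parallel>y - x\<parallel>\<^sup>2\<close>, which is the
  derivative of the quadratic term.
\<close>

lemma descent_lemma:
  assumes "is_gradient T \<psi>" and L: "L-lipschitz_on UNIV T"
  shows "\<psi> y \<le> \<psi> x + T x \<bullet> (y - x) + L / 2 * (norm (y - x))\<^sup>2"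
proof -
  let ?d = "y - x"
  let ?k = "\<lambda>t. \<psi> (x + t *\<^sub>R ?d) - t * (?d \<bullet> T x) - L / 2 * t\<^sup>2 * (norm ?d)\<^sup>2"
  have "?k 1 \<le> ?k 0"
  proof (rule DERIV_nonpos_imp_nonincreasing[of 0 1])
    fix t :: real
    assume t: "0 \<le> t" "t \<le> 1"
    let ?D = "?d \<bullet> T (x + t *\<^sub>R ?d) - ?d \<bullet> T x - L * t * (norm ?d)\<^sup>2"
    have "(?k has_real_derivative ?D) (at t)"
      by (auto intro!: derivative_eq_intros has_real_derivative_along_line[OF assms(1)])
    moreover have "?D \<le> 0"
    proof -
      have "?d \<bullet> (T (x + t *\<^sub>R ?d) - T x) \<le> norm ?d * norm (T (x + t *\<^sub>R ?d) - T x)"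
        by (rule norm_cauchy_schwarz)
      also have "\<dots> \<le> norm ?d * (L * norm (t *\<^sub>R ?d))"
        using lipschitz_onD[OF L, of "x + t *\<^sub>R ?d" x]
        by (intro mult_left_mono) (auto simp: dist_norm)
      also have "\<dots> = L * t * (norm ?d)\<^sup>2" using t by (simp add: power2_eq_square)
      finally show ?thesis by (simp add: inner_diff_right)
    qed
    ultimately show "\<exists>D. (?k has_real_derivative D) (at t) \<and> D \<le> 0" by blast
  qed simp
  then show ?thesis by (simp add: inner_commute)
qed

text \<open>
  A gradient step for \<open>\<psi> - \<langle>T x, \<cdot>\<rangle>\<close>, started at \<open>y\<close>, cannot fall below the minimum of this function,
  attained at \<open>x\<close>. By the descent lemma the step gains \<open>\<beta>/2 \<parallel>T y - T x\<parallel>\<^sup>2\<close>, which improves the gradient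
  inequality by that amount; adding the improved inequality with \<open>x\<close> and \<open>y\<close> exchanged gives
  cocoercivity.
\<close>

lemma baillon_haddad:
  assumes pot: "convex_potential T \<psi>" and "0 < \<beta>" and L: "(1 / \<beta>)-lipschitz_on UNIV T"
  shows "cocoercive \<beta> T"
proof -
  have grad: "is_gradient T \<psi>" using pot by (simp add: convex_potential_def)
  have gap: "\<psi> x + T x \<bullet> (y - x) + \<beta> / 2 * (norm (T y - T x))\<^sup>2 \<le> \<psi> y" for x y
  proof -
    \<comment> \<open>The point \<open>?z\<close> is the step of length \<open>\<beta>\<close> from \<open>y\<close> against the gradient \<open>?e\<close> of \<open>\<psi> - \<langle>T x, \<cdot>\<rangle>\<close>.\<close>
    let ?e = "T y - T x"
    let ?z = "y - \<beta> *\<^sub>R ?e"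
    have "\<psi> x + T x \<bullet> (?z - x) \<le> \<psi> ?z"
      using convex_potential_is_subgradient[OF pot, of x] by (auto simp: is_subgradient_def)
    also have "\<dots> \<le> \<psi> y + T y \<bullet> (?z - y) + (1 / \<beta>) / 2 * (norm (?z - y))\<^sup>2"
      by (rule descent_lemma[OF grad L])
    also have "(1 / \<beta>) / 2 * (norm (?z - y))\<^sup>2 = \<beta> / 2 * (norm ?e)\<^sup>2"
      using \<open>0 < \<beta>\<close> by (simp add: power_mult_distrib power2_eq_square)
    also have "T y \<bullet> (?z - y) = - \<beta> * (T y \<bullet> ?e)" by simp
    also have "T x \<bullet> (?z - x) = T x \<bullet> (y - x) - \<beta> * (T x \<bullet> ?e)"
      by (simp add: inner_diff_right[of _ y] inner_diff_right[of _ _ x] inner_diff_right[of _ _ "\<beta> *\<^sub>R _"])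
    finally have "\<psi> x + T x \<bullet> (y - x) + \<beta> * (T y \<bullet> ?e - T x \<bullet> ?e) \<le> \<psi> y + \<beta> / 2 * (norm ?e)\<^sup>2"
      by (simp add: right_diff_distrib)
    also have "T y \<bullet> ?e - T x \<bullet> ?e = (norm ?e)\<^sup>2"
      by (simp add: power2_norm_eq_inner inner_diff_left)
    finally show ?thesis by simp
  qed
  have "\<beta> * (norm (T x - T y))\<^sup>2 \<le> (x - y) \<bullet> (T x - T y)" for x y
    using gap[of x y] gap[of y x]
    by (simp add: norm_minus_commute[of "T y"] inner_diff_left inner_diff_right inner_commute)
  then show ?thesis using \<open>0 < \<beta>\<close> by (simp add: cocoercive_iff)
qed

text \<open>
  Conjugating the quadratic upper bound of the descent lemma at \<open>x\<close> gives the lower bound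
  \<open>\<psi>\<^sup>*(y) \<ge> \<langle>x, y\<rangle> - \<psi>(x) + \<beta>/2 \<parallel>y - T x\<parallel>\<^sup>2\<close>. After subtraction of \<open>\<beta>/2 \<parallel>y\<parallel>\<^sup>2\<close> the right-hand side is
  affine in \<open>y\<close>. Dropping the square in the lower bound and taking the supremum over \<open>x\<close> already
  recovers \<open>\<psi>\<^sup>*(y)\<close>, so the supremum of these affine functions is exactly
  \<open>\<psi>\<^sup>* - \<beta>/2 \<parallel>\<cdot>\<parallel>\<^sup>2\<close>.
\<close>

lemma fenchel_conj_minus_square_Gamma0:
  assumes pot: "convex_potential T \<psi>" and "0 < \<beta>" and L: "(1 / \<beta>)-lipschitz_on UNIV T"
  shows "(\<lambda>y. fenchel_conj (\<lambda>x. ereal (\<psi> x)) y - ereal (\<beta> / 2 * (norm y)\<^sup>2)) \<in> Gamma0"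
proof (rule SUP_affine_Gamma0)
  let ?c = "fenchel_conj (\<lambda>x. ereal (\<psi> x))"
  let ?a = "\<lambda>x. x - \<beta> *\<^sub>R T x" and ?b = "\<lambda>x. \<beta> / 2 * (norm (T x))\<^sup>2 - \<psi> x"
  have grad: "is_gradient T \<psi>" using pot by (simp add: convex_potential_def)
  have complete: "y \<bullet> ?a x + ?b x + \<beta> / 2 * (norm y)\<^sup>2
      = y \<bullet> x - \<psi> x + \<beta> / 2 * (norm (y - T x))\<^sup>2" for x y
    unfolding power2_norm_eq_inner
    by (simp add: inner_diff_left inner_diff_right inner_commute) (simp add: algebra_simps)
  have strong: "ereal (y \<bullet> x - \<psi> x + \<beta> / 2 * (norm (y - T x))\<^sup>2) \<le> ?c y" for x y
  proof -
    \<comment> \<open>The point \<open>?z\<close> maximizes \<open>\<langle>z, y\<rangle>\<close> minus the quadratic upper bound at \<open>x\<close>.\<close>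
    let ?e = "y - T x"
    let ?z = "x + \<beta> *\<^sub>R ?e"
    have "\<psi> ?z \<le> \<psi> x + T x \<bullet> (?z - x) + (1 / \<beta>) / 2 * (norm (?z - x))\<^sup>2"
      by (rule descent_lemma[OF grad L])
    also have "(1 / \<beta>) / 2 * (norm (?z - x))\<^sup>2 = \<beta> / 2 * (norm ?e)\<^sup>2"
      using \<open>0 < \<beta>\<close> by (simp add: power_mult_distrib power2_eq_square)
    also have "T x \<bullet> (?z - x) = \<beta> * (T x \<bullet> ?e)" by simp
    also have "T x \<bullet> ?e = y \<bullet> ?e - (norm ?e)\<^sup>2"
      by (simp add: power2_norm_eq_inner inner_diff_left)
    finally have "y \<bullet> x - \<psi> x + \<beta> / 2 * (norm ?e)\<^sup>2 \<le> y \<bullet> ?z - \<psi> ?z"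
      by (simp add: inner_add_right right_diff_distrib)
    also have "ereal \<dots> \<le> ?c y"
      using fenchel_young[of y ?z "\<lambda>x. ereal (\<psi> x)"] by simp
    finally show ?thesis by simp
  qed
  show "?c y - ereal (\<beta> / 2 * (norm y)\<^sup>2) = (SUP x\<in>UNIV. ereal (y \<bullet> ?a x + ?b x))" for y
  proof (rule antisym)
    have "?c y \<le> (SUP x\<in>UNIV. ereal (y \<bullet> ?a x + ?b x)) + ereal (\<beta> / 2 * (norm y)\<^sup>2)"
      unfolding fenchel_conj_def
    proof (rule SUP_least)
      fix x
      have "ereal (y \<bullet> x) - ereal (\<psi> x) \<le> ereal (y \<bullet> ?a x + ?b x) + ereal (\<beta> / 2 * (norm y)\<^sup>2)"
        using complete[of y x] \<open>0 < \<beta>\<close> by simp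
      also have "\<dots> \<le> (SUP x\<in>UNIV. ereal (y \<bullet> ?a x + ?b x)) + ereal (\<beta> / 2 * (norm y)\<^sup>2)"
        by (intro add_right_mono SUP_upper) simp
      finally show "ereal (y \<bullet> x) - ereal (\<psi> x) \<le> \<dots>" .
    qed
    then show "?c y - ereal (\<beta> / 2 * (norm y)\<^sup>2) \<le> (SUP x\<in>UNIV. ereal (y \<bullet> ?a x + ?b x))"
      by (simp add: ereal_minus_le)
    show "(SUP x\<in>UNIV. ereal (y \<bullet> ?a x + ?b x)) \<le> ?c y - ereal (\<beta> / 2 * (norm y)\<^sup>2)"
    proof (rule SUP_least)
      fix x
      show "ereal (y \<bullet> ?a x + ?b x) \<le> ?c y - ereal (\<beta> / 2 * (norm y)\<^sup>2)"
        using strong[of y x] complete[of y x] by (cases "?c y") auto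
    qed
  qed
  have "is_subgradient ?c (T 0) 0"
    by (intro is_subgradient_fenchel_conj convex_potential_is_subgradient pot)
  then show "?c (T 0) - ereal (\<beta> / 2 * (norm (T 0))\<^sup>2) \<noteq> \<infinity>"
    by (cases "?c (T 0)") (auto simp: is_subgradient_def)
qed simp

section \<open>Proximity operators versus gradients\<close>

lemma sProx_condition_consequences:
  fixes T :: "'a::real_inner \<Rightarrow> 'a"
  assumes "0 < \<beta>" and C1: "sProx_condition \<beta> T \<phi>"
  defines "\<phi>c \<equiv> \<lambda>x. \<phi> x + ereal ((1 - \<beta>) / 2 * (norm x)\<^sup>2)"
    and "g \<equiv> \<lambda>x. \<phi> x + ereal (1 / 2 * (norm x)\<^sup>2)"
  shows "fenchel_conj g \<in> Gamma0"
    and "is_gradient_ereal T (fenchel_conj g)"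
    and "fenchel_conj \<phi>c \<in> Gamma0"
    and "moreau_env \<beta> (fenchel_conj \<phi>c) = fenchel_conj g"
    and "cocoercive \<beta> T"
proof -
  have g: "g = (\<lambda>x. \<phi>c x + ereal (\<beta> / 2 * (norm x)\<^sup>2))"
  proof
    have "(1 - \<beta>) / 2 * (norm x)\<^sup>2 + \<beta> / 2 * (norm x)\<^sup>2 = 1 / 2 * (norm x)\<^sup>2" for x :: 'a
      by (simp add: field_simps)
    then show "g x = \<phi>c x + ereal (\<beta> / 2 * (norm x)\<^sup>2)" for x
      unfolding g_def \<phi>c_def by (cases "\<phi> x") (auto simp del: times_divide_eq_left)
  qed
  have Gamma: "proper_fun \<phi>c" "convex_fun \<phi>c"
    using C1 by (auto simp: sProx_condition_def Gamma0_def \<phi>c_def)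
  have "is_sProx T \<phi>" using C1 by (simp add: sProx_condition_def)
  then have sub_g: "is_subgradient g (T x) x" and "proper_fun \<phi>" for x
    unfolding is_sProx_iff g_def by auto
  have proper_g: "proper_fun g"
    using \<open>proper_fun \<phi>\<close> by (auto simp: proper_fun_def g_def)
  have sub_\<phi>c: "is_subgradient \<phi>c (T x) (x - \<beta> *\<^sub>R T x)" for x
    using Gamma(2) sub_g[of x] unfolding g by (rule is_subgradient_remove_square)
  show "cocoercive \<beta> T"
    unfolding cocoercive_iff[OF \<open>0 < \<beta>\<close>]
  proof (intro allI)
    fix x y
    have "0 \<le> (T x - T y) \<bullet> ((x - \<beta> *\<^sub>R T x) - (y - \<beta> *\<^sub>R T y))"
      by (rule is_subgradient_monotone[OF sub_\<phi>c sub_\<phi>c])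
    also have "(x - \<beta> *\<^sub>R T x) - (y - \<beta> *\<^sub>R T y) = (x - y) - \<beta> *\<^sub>R (T x - T y)"
      by (simp add: algebra_simps)
    finally show "\<beta> * (norm (T x - T y))\<^sup>2 \<le> (x - y) \<bullet> (T x - T y)"
      by (simp add: inner_diff_right[of _ "x - y"] power2_norm_eq_inner inner_commute)
  qed
  show "fenchel_conj g \<in> Gamma0" by (rule fenchel_conj_Gamma0[OF sub_g proper_g])
  show "fenchel_conj \<phi>c \<in> Gamma0" by (rule fenchel_conj_Gamma0[OF sub_\<phi>c Gamma(1)])
  show "is_gradient_ereal T (fenchel_conj g)"
    by (rule is_subgradient_imp_gradient[OF is_subgradient_fenchel_conj[OF sub_g]
          cocoercive_imp_lipschitz[OF \<open>0 < \<beta>\<close> \<open>cocoercive \<beta> T\<close>]])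
  show "moreau_env \<beta> (fenchel_conj \<phi>c) = fenchel_conj g"
    using moreau_env_fenchel_conj[OF \<open>0 < \<beta>\<close> sub_\<phi>c] fenchel_conj_subgradient[OF sub_g]
    by (simp add: fun_eq_iff g)
qed

lemma gradient_condition_imp_sProx_condition:
  fixes T :: "'a::real_inner \<Rightarrow> 'a"
  assumes "0 < \<beta>" and C2: "gradient_condition \<beta> T \<psi>"
  defines "\<phi> \<equiv> \<lambda>x. fenchel_conj (\<lambda>y. ereal (\<psi> y)) x - ereal (1 / 2 * (norm x)\<^sup>2)"
  shows "sProx_condition \<beta> T \<phi>"
proof -
  let ?\<psi> = "\<lambda>y. ereal (\<psi> y)"
  have pot: "convex_potential T \<psi>" and coco: "cocoercive \<beta> T"
    using C2 by (auto simp: gradient_condition_def)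
  have grad: "is_gradient T \<psi>" using pot by (simp add: convex_potential_def)
  have sub: "is_subgradient ?\<psi> x (T x)" for x
    by (rule convex_potential_is_subgradient[OF pot])
  have \<phi>c: "\<phi> x + ereal ((1 - \<beta>) / 2 * (norm x)\<^sup>2)
      = fenchel_conj ?\<psi> x - ereal (\<beta> / 2 * (norm x)\<^sup>2)" for x
    unfolding \<phi>_def by (cases "fenchel_conj ?\<psi> x") (auto simp: field_simps)
  have Gamma: "(\<lambda>x. \<phi> x + ereal ((1 - \<beta>) / 2 * (norm x)\<^sup>2)) \<in> Gamma0"
    unfolding \<phi>c
    by (rule fenchel_conj_minus_square_Gamma0[OF pot \<open>0 < \<beta>\<close> cocoercive_imp_lipschitz[OF \<open>0 < \<beta>\<close> coco]])
  then have proper: "proper_fun \<phi>"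
    by (auto simp: Gamma0_def proper_fun_def)
  have "(\<lambda>x. \<phi> x + ereal (1 / 2 * (norm x)\<^sup>2)) = fenchel_conj ?\<psi>"
  proof
    show "\<phi> x + ereal (1 / 2 * (norm x)\<^sup>2) = fenchel_conj ?\<psi> x" for x
      unfolding \<phi>_def by (cases "fenchel_conj ?\<psi> x") auto
  qed
  moreover have "is_subgradient (fenchel_conj ?\<psi>) m x \<longleftrightarrow> m = T x" for m x
    using is_subgradient_fenchel_conj[OF sub] is_subgradient_of_fenchel_conj[OF sub]
      is_subgradient_unique_gradient[OF grad] by blast
  ultimately have "is_sProx T \<phi>"
    using proper by (simp add: is_sProx_iff)
  then show ?thesis
    using Gamma proper by (auto simp: sProx_condition_def proper_fun_def)
qed

theorem theorem1:
  fixes T :: "'a::{real_inner, complete_space} \<Rightarrow> 'a" and \<beta> :: real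
  assumes "0 < \<beta>" and "\<beta> < 1"
  shows
    "((\<exists>\<phi>. sProx_condition \<beta> T \<phi>) \<longleftrightarrow> (\<exists>\<psi>. gradient_condition \<beta> T \<psi>)) \<and>
     (\<forall>\<psi>. convex_potential T \<psi> \<longrightarrow>
        (cocoercive \<beta> T \<longleftrightarrow> (1 / \<beta>)-lipschitz_on UNIV T)) \<and>
     (\<forall>\<phi> \<phi>c. sProx_condition \<beta> T \<phi> \<longrightarrow>
        \<phi>c = (\<lambda>x. \<phi> x + ereal ((1 - \<beta>) / 2 * (norm x)\<^sup>2)) \<longrightarrow>
          is_sProx T \<phi> \<and>
          is_gradient_ereal T (fenchel_conj (\<lambda>x. \<phi> x + ereal (1 / 2 * (norm x)\<^sup>2))) \<and>
          fenchel_conj \<phi>c \<in> Gamma0 \<and>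
          is_gradient_ereal T (moreau_env \<beta> (fenchel_conj \<phi>c)) \<and>
          cocoercive \<beta> T \<and>
          (1 / \<beta>)-lipschitz_on UNIV T \<and>
          maximally_monotone T) \<and>
     (\<forall>\<psi> \<phi>. gradient_condition \<beta> T \<psi> \<longrightarrow>
        \<phi> = (\<lambda>x. fenchel_conj (\<lambda>y. ereal (\<psi> y)) x - ereal (1 / 2 * (norm x)\<^sup>2)) \<longrightarrow>
          is_gradient T \<psi> \<and>
          is_sProx T \<phi> \<and>
          weakly_convex (1 - \<beta>) \<phi>)"
proof (intro conjI allI impI)
  have from_C1: "gradient_condition \<beta> T (\<lambda>x. real_of_ereal
      (fenchel_conj (\<lambda>y. \<phi> y + ereal (1 / 2 * (norm y)\<^sup>2)) x))"
    if C1: "sProx_condition \<beta> T \<phi>" for \<phi>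
  proof -
    let ?c = "fenchel_conj (\<lambda>y. \<phi> y + ereal (1 / 2 * (norm y)\<^sup>2))"
    note a = sProx_condition_consequences[OF \<open>0 < \<beta>\<close> C1]
    have "(\<lambda>x. ereal (real_of_ereal (?c x))) = ?c"
      using a(2) by (simp add: is_gradient_ereal_def ereal_real' fun_eq_iff)
    then show ?thesis
      using a(1,2,5)
      by (simp add: gradient_condition_def convex_potential_def is_gradient_ereal_def)
  qed
  show "(\<exists>\<phi>. sProx_condition \<beta> T \<phi>) \<longleftrightarrow> (\<exists>\<psi>. gradient_condition \<beta> T \<psi>)"
    using from_C1 gradient_condition_imp_sProx_condition[OF \<open>0 < \<beta>\<close>] by blast
next
  fix \<psi>
  assume "convex_potential T \<psi>"
  then show "cocoercive \<beta> T \<longleftrightarrow> (1 / \<beta>)-lipschitz_on UNIV T"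
    using baillon_haddad cocoercive_imp_lipschitz \<open>0 < \<beta>\<close> by blast
next
  fix \<phi> \<phi>c
  assume C1: "sProx_condition \<beta> T \<phi>"
    and \<phi>c: "\<phi>c = (\<lambda>x. \<phi> x + ereal ((1 - \<beta>) / 2 * (norm x)\<^sup>2))"
  note a = sProx_condition_consequences[OF \<open>0 < \<beta>\<close> C1, folded \<phi>c]
  show "is_sProx T \<phi>" using C1 by (simp add: sProx_condition_def)
  show "is_gradient_ereal T (fenchel_conj (\<lambda>x. \<phi> x + ereal (1 / 2 * (norm x)\<^sup>2)))" by (rule a)
  show "fenchel_conj \<phi>c \<in> Gamma0" by (rule a)
  show "is_gradient_ereal T (moreau_env \<beta> (fenchel_conj \<phi>c))" unfolding a(4) by (rule a)
  show "cocoercive \<beta> T" by (rule a)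
  then show lip: "(1 / \<beta>)-lipschitz_on UNIV T"
    by (rule cocoercive_imp_lipschitz[OF \<open>0 < \<beta>\<close>])
  have "0 \<le> (x - y) \<bullet> (T x - T y)" for x y
  proof -
    have "0 \<le> \<beta> * (norm (T x - T y))\<^sup>2" using \<open>0 < \<beta>\<close> by simp
    also have "\<dots> \<le> (x - y) \<bullet> (T x - T y)"
      using \<open>cocoercive \<beta> T\<close> by (simp add: cocoercive_iff[OF \<open>0 < \<beta>\<close>])
    finally show ?thesis .
  qed
  then show "maximally_monotone T"
    using \<open>0 < \<beta>\<close> by (intro lipschitz_monotone_imp_maximally_monotone[OF lip]) auto
next
  fix \<psi> \<phi>
  assume C2: "gradient_condition \<beta> T \<psi>"
    and \<phi>: "\<phi> = (\<lambda>x. fenchel_conj (\<lambda>y. ereal (\<psi> y)) x - ereal (1 / 2 * (norm x)\<^sup>2))"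
  have C1: "sProx_condition \<beta> T \<phi>"
    unfolding \<phi> by (rule gradient_condition_imp_sProx_condition[OF \<open>0 < \<beta>\<close> C2])
  show "is_gradient T \<psi>"
    using C2 by (simp add: gradient_condition_def convex_potential_def)
  show "is_sProx T \<phi>" and "weakly_convex (1 - \<beta>) \<phi>"
    using C1 by (auto simp: sProx_condition_def weakly_convex_def Gamma0_def)
qed

end
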